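(* Let $\mathcal{A}=\langle A,*,\neg_r,\neg_l,0,1,\le\rangle$ be such that $\langle A,*,1,\le\rangle$ is a partially ordered monoid, $\neg_r,\neg_l$ are unary operations on $A$ and $0\in A$. The following are equivalent: (i) for all $a,b\in A$: $a*b\le 0$ iff $b\le\neg_r a$ iff $a\le\neg_l b$; (ii) the operations $\neg_r$ and $\neg_l$ are antimonotone (i.e. $a\le b$ implies $\neg_r b\le\neg_r a$ and $\neg_l b\le\neg_l a$), and for all $x,y\in A$: $\neg_r 1\le 0$, $1\le\neg_r 0$, $x*\neg_r(y*x)\le\neg_r y$, $\neg_l 1\le 0$, $1\le\neg_l 0$, and $\neg_l(x*y)*x\le\neg_l y$.
   Context: A partially ordered monoid is a structure $\langle A,*,1,\le\rangle$ where $\langle A,*,1\rangle$ is a monoid, $\le$ is a partial order on $A$, and $*$ is monotone in both arguments ($a\le c$ and $b\le d$ imply $a*b\le c*d$). *)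

theory Defs
  imports Main
begin

class po_monoid = monoid_mult + order +
  assumes mult_isotone: "a \<le> c \<Longrightarrow> b \<le> d \<Longrightarrow> a * b \<le> c * d"

end

theory Submission
  imports Defs
begin

text \<open>Condition (i) makes \<open>negr a\<close> the largest right multiplier, and
  \<open>negl a\<close> the largest left multiplier, that sends \<open>a\<close> below
  \<open>z\<close>. Each inequality of (ii) then reduces to bounding a product by \<open>z\<close>.
  Conversely, the mixed inequality \<open>x * negr (y * x) \<le> negr y\<close> encodes the
  adjunction: \<open>y = 1\<close> gives the counit \<open>x * negr x \<le> z\<close>, and for
  \<open>a * b \<le> z\<close> it lets the factor \<open>b\<close> escape from
  \<open>negr (a * b)\<close>. The case of \<open>negl\<close> is the mirror image.\<close>

theorem theorem14:
  fixes negr negl :: "'a::po_monoid \<Rightarrow> 'a" and z :: 'a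
  shows
    "(\<forall>a b. (a * b \<le> z \<longleftrightarrow> b \<le> negr a) \<and> (b \<le> negr a \<longleftrightarrow> a \<le> negl b))
     \<longleftrightarrow>
     (antimono negr \<and> antimono negl \<and>
      (\<forall>x y. negr 1 \<le> z \<and> 1 \<le> negr z \<and> x * negr (y * x) \<le> negr y \<and>
             negl 1 \<le> z \<and> 1 \<le> negl z \<and> negl (x * y) * x \<le> negl y))"
  (is "?residuated \<longleftrightarrow> ?equational")
proof
  assume ?residuated
  then have r: "a * b \<le> z \<longleftrightarrow> b \<le> negr a" and l: "a * b \<le> z \<longleftrightarrow> a \<le> negl b" for a b
    by blast+
  \<comment> \<open>The counits of the two adjunctions, obtained by reflexivity at
    \<open>negr a\<close> and \<open>negl a\<close>.\<close>
  have r0: "a * negr a \<le> z" and l0: "negl a * a \<le> z" for a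
    using r[of a "negr a"] l[of "negl a" a] by simp_all
  have "antimono negr"
  proof (rule antimonoI)
    fix a b :: 'a assume "a \<le> b"
    then have "a * negr b \<le> b * negr b" by (simp add: mult_isotone)
    then show "negr b \<le> negr a" using r0 r order_trans by blast
  qed
  moreover have "antimono negl"
  proof (rule antimonoI)
    fix a b :: 'a assume "a \<le> b"
    then have "negl b * a \<le> negl b * b" by (simp add: mult_isotone)
    then show "negl b \<le> negl a" using l0 l order_trans by blast
  qed
  moreover have "negr 1 \<le> z" "negl 1 \<le> z"
    using r0[of 1] l0[of 1] by simp_all
  moreover have "1 \<le> negr z" "1 \<le> negl z"
    using r[of z 1] l[of 1 z] by simp_all
  moreover have "x * negr (y * x) \<le> negr y" for x y
    \<comment> \<open>Reassociating the counit at \<open>y * x\<close> isolates \<open>y\<close> as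
      the left factor, so residuation applies to the rest.\<close>
    using r0[of "y * x"] r[of y "x * negr (y * x)"] by (simp add: mult.assoc)
  moreover have "negl (x * y) * x \<le> negl y" for x y
    using l0[of "x * y"] l[of "negl (x * y) * x" y] by (simp add: mult.assoc)
  ultimately show ?equational by blast
next
  assume ?equational
  then have anti: "antimono negr" "antimono negl"
    and one: "negr 1 \<le> z" "1 \<le> negr z" "negl 1 \<le> z" "1 \<le> negl z"
    and r: "x * negr (y * x) \<le> negr y" and l: "negl (x * y) * x \<le> negl y" for x y
    by blast+
  have "a * b \<le> z \<longleftrightarrow> b \<le> negr a" for a b
  proof
    assume "a * b \<le> z"
    \<comment> \<open>Antimonotonicity lifts \<open>1 \<le> negr z\<close> to
      \<open>negr (a * b)\<close>; multiplying by \<open>b\<close> on the left then bounds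
      \<open>b\<close> itself.\<close>
    then have "1 \<le> negr (a * b)" using order_trans[OF one(2) antimonoD[OF anti(1)]] by simp
    then have "b * 1 \<le> b * negr (a * b)" by (simp only: mult_isotone order_refl)
    then show "b \<le> negr a" using r[of b a] by simp
  next
    assume "b \<le> negr a"
    then have "a * b \<le> a * negr a" by (simp add: mult_isotone)
    \<comment> \<open>The instance \<open>y = 1\<close> of the mixed inequality recovers the counit
      up to \<open>negr 1 \<le> z\<close>.\<close>
    also have "\<dots> \<le> negr 1" using r[of a 1] by simp
    finally show "a * b \<le> z" using one(1) by simp
  qed
  moreover have "a * b \<le> z \<longleftrightarrow> a \<le> negl b" for a b
  proof
    assume "a * b \<le> z"
    then have "1 \<le> negl (a * b)" using order_trans[OF one(4) antimonoD[OF anti(2)]] by simp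
    then have "1 * a \<le> negl (a * b) * a" by (simp only: mult_isotone order_refl)
    then show "a \<le> negl b" using l[of a b] by simp
  next
    assume "a \<le> negl b"
    then have "a * b \<le> negl b * b" by (simp add: mult_isotone)
    also have "\<dots> \<le> negl 1" using l[of b 1] by simp
    finally show "a * b \<le> z" using one(3) by simp
  qed
  ultimately show ?residuated by blast
qed

end
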